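(* Let $(I,\tilde g,V,\lambda,\mu)$ be an almost $\eta$-Ricci soliton with $V=\frac{\partial}{\partial x^3}$. Suppose that $f_1,f_2$ depend only on $x^2$, that the components of $\eta=\sum_{k=1}^3\eta^ke_k$ are all equal, $\eta^1=\eta^2=\eta^3=:f$, and that $\mu$ is nowhere zero on $I$. Then $\eta=0$ and $\lambda=0$. Moreover, $f_1$ is constant, or $f_1'$ is nowhere zero and $f_2=c_0\frac{f_1^2}{f_1'}$, where $c_0\in\mathbb R\setminus\{0\}$.
   Context: Let $I=I_1\times I_2\times I_3\subseteq\mathbb R^3$ with $I_1,I_2,I_3\subseteq\mathbb R$ open intervals and standard coordinates $x^1,x^2,x^3$. Let $f_1,f_2$ be smooth nowhere zero functions on $I$ and endow $I$ with the Riemannian metric $\tilde g=\frac{1}{f_1^2}dx^1\otimes dx^1+\frac{1}{f_2^2}dx^2\otimes dx^2+dx^3\otimes dx^3$. Let $E_1=f_1\frac{\partial}{\partial x^1}$, $E_2=f_2\frac{\partial}{\partial x^2}$, $E_3=\frac{\partial}{\partial x^3}$ (an orthonormal frame), and let $e_1,e_2,e_3$ be the dual $1$-forms. For a smooth vector field $V$, a $1$-form $\eta$, and smooth functions $\lambda,\mu$ on $I$ with $\mu\neq0$, $(I,\tilde g,V,\lambda,\mu)$ is an almost $\eta$-Ricci soliton if $\frac12\pounds_V\tilde g+\mathrm{Ric}+\lambda\tilde g+\mu\,\eta\otimes\eta=0$ on $I$, where $\pounds_V\tilde g$ is the Lie derivative of $\tilde g$ along $V$ and $\mathrm{Ric}$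 is the Ricci tensor of $\tilde g$, with $\mathrm{Ric}(Y,Z)=\sum_{k}\tilde g(R(E_k,Y)Z,E_k)$, $R(X,Y)Z=\nabla_X\nabla_YZ-\nabla_Y\nabla_XZ-\nabla_{[X,Y]}Z$, $\nabla$ the Levi-Civita connection. A prime denotes the derivative with respect to $x^2$. *)

theory Defs
  imports "HOL-Analysis.Analysis"
begin

type_synonym 'n scalar_field = "real ^ 'n \<Rightarrow> real"
type_synonym 'n vector_field = "real ^ 'n \<Rightarrow> real ^ 'n"
type_synonym 'n one_form = "real ^ 'n \<Rightarrow> real ^ 'n \<Rightarrow> real"
type_synonym 'n bilinear_field = "real ^ 'n \<Rightarrow> real ^ 'n \<Rightarrow> real ^ 'n \<Rightarrow> real"
type_synonym 'n connection = "'n vector_field \<Rightarrow> 'n vector_field \<Rightarrow> 'n vector_field"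

text \<open>
  Tensor fields on an open set \<open>U\<close> are total functions on \<open>real ^ 'n\<close>, of which only the
  values at points of \<open>U\<close> matter; vectors are given by their components in the standard
  coordinates, so that \<open>axis i 1\<close> is the \<open>i\<close>-th coordinate vector.
\<close>

definition coord_field :: "'n::finite \<Rightarrow> 'n vector_field" where
  "coord_field i = (\<lambda>x. axis i 1)"

definition dir_deriv :: "'n::finite vector_field \<Rightarrow> 'n scalar_field \<Rightarrow> 'n scalar_field" where
  "dir_deriv X h = (\<lambda>x. frechet_derivative h (at x) (X x))"

definition partial_deriv :: "'n::finite \<Rightarrow> 'n scalar_field \<Rightarrow> 'n scalar_field" where
  "partial_deriv i = dir_deriv (coord_field i)"

text \<open>The notions of smoothness below are meant for open sets \<open>U\<close> only.\<close>

primrec Ck_on :: "nat \<Rightarrow> (real ^ 'n::finite) set \<Rightarrow> 'n scalar_field \<Rightarrow> bool" where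
  "Ck_on 0 U h \<longleftrightarrow> continuous_on U h"
| "Ck_on (Suc k) U h \<longleftrightarrow> h differentiable_on U \<and> (\<forall>i. Ck_on k U (partial_deriv i h))"

definition smooth_fun_on :: "(real ^ 'n::finite) set \<Rightarrow> 'n scalar_field \<Rightarrow> bool" where
  "smooth_fun_on U h \<longleftrightarrow> (\<forall>k. Ck_on k U h)"

definition smooth_field_on :: "(real ^ 'n::finite) set \<Rightarrow> 'n vector_field \<Rightarrow> bool" where
  "smooth_field_on U X \<longleftrightarrow> (\<forall>i. smooth_fun_on U (\<lambda>x. X x $ i))"

definition smooth_one_form_on :: "(real ^ 'n::finite) set \<Rightarrow> 'n one_form \<Rightarrow> bool" where
  "smooth_one_form_on U \<eta> \<longleftrightarrow>
     (\<forall>x\<in>U. linear (\<eta> x)) \<and> (\<forall>i. smooth_fun_on U (\<lambda>x. \<eta> x (axis i 1)))"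

definition lie_bracket :: "'n::finite vector_field \<Rightarrow> 'n vector_field \<Rightarrow> 'n vector_field" where
  "lie_bracket X Y =
     (\<lambda>x. \<chi> i. dir_deriv X (\<lambda>y. Y y $ i) x - dir_deriv Y (\<lambda>y. X y $ i) x)"

definition eval_form :: "'n one_form \<Rightarrow> 'n vector_field \<Rightarrow> 'n scalar_field" where
  "eval_form \<eta> X = (\<lambda>x. \<eta> x (X x))"

definition eval_bilin ::
  "'n bilinear_field \<Rightarrow> 'n vector_field \<Rightarrow> 'n vector_field \<Rightarrow> 'n scalar_field" where
  "eval_bilin g X Y = (\<lambda>x. g x (X x) (Y x))"

definition lie_deriv_bilin :: "'n::finite vector_field \<Rightarrow> 'n bilinear_field \<Rightarrow>
    'n vector_field \<Rightarrow> 'n vector_field \<Rightarrow> 'n scalar_field" where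
  "lie_deriv_bilin V g X Y = (\<lambda>x. dir_deriv V (eval_bilin g X Y) x
     - eval_bilin g (lie_bracket V X) Y x - eval_bilin g X (lie_bracket V Y) x)"

text \<open>
  The first two conditions say that \<open>nabla\<close> is a well-defined operation on smooth vector fields
  over \<open>U\<close>, the remaining ones are the axioms of an affine connection.
\<close>

definition affine_connection_on :: "(real ^ 'n::finite) set \<Rightarrow> 'n connection \<Rightarrow> bool" where
  "affine_connection_on U nabla \<longleftrightarrow>
     (\<forall>X Y. smooth_field_on U X \<longrightarrow> smooth_field_on U Y \<longrightarrow> smooth_field_on U (nabla X Y)) \<and>
     (\<forall>X X' Y Y'. smooth_field_on U X \<longrightarrow> smooth_field_on U X' \<longrightarrow>
        smooth_field_on U Y \<longrightarrow> smooth_field_on U Y' \<longrightarrow>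
        (\<forall>x\<in>U. X x = X' x) \<longrightarrow> (\<forall>x\<in>U. Y x = Y' x) \<longrightarrow> (\<forall>x\<in>U. nabla X Y x = nabla X' Y' x)) \<and>
     (\<forall>X X' Y. smooth_field_on U X \<longrightarrow> smooth_field_on U X' \<longrightarrow> smooth_field_on U Y \<longrightarrow>
        (\<forall>x\<in>U. nabla (\<lambda>y. X y + X' y) Y x = nabla X Y x + nabla X' Y x)) \<and>
     (\<forall>h X Y. smooth_fun_on U h \<longrightarrow> smooth_field_on U X \<longrightarrow> smooth_field_on U Y \<longrightarrow>
        (\<forall>x\<in>U. nabla (\<lambda>y. h y *\<^sub>R X y) Y x = h x *\<^sub>R nabla X Y x)) \<and>
     (\<forall>X Y Y'. smooth_field_on U X \<longrightarrow> smooth_field_on U Y \<longrightarrow> smooth_field_on U Y' \<longrightarrow>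
        (\<forall>x\<in>U. nabla X (\<lambda>y. Y y + Y' y) x = nabla X Y x + nabla X Y' x)) \<and>
     (\<forall>h X Y. smooth_fun_on U h \<longrightarrow> smooth_field_on U X \<longrightarrow> smooth_field_on U Y \<longrightarrow>
        (\<forall>x\<in>U. nabla X (\<lambda>y. h y *\<^sub>R Y y) x = h x *\<^sub>R nabla X Y x + dir_deriv X h x *\<^sub>R Y x))"

definition levi_civita_on ::
  "(real ^ 'n::finite) set \<Rightarrow> 'n bilinear_field \<Rightarrow> 'n connection \<Rightarrow> bool" where
  "levi_civita_on U g nabla \<longleftrightarrow> affine_connection_on U nabla \<and>
     (\<forall>X Y. smooth_field_on U X \<longrightarrow> smooth_field_on U Y \<longrightarrow>
        (\<forall>x\<in>U. nabla X Y x - nabla Y X x = lie_bracket X Y x)) \<and>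
     (\<forall>X Y Z. smooth_field_on U X \<longrightarrow> smooth_field_on U Y \<longrightarrow> smooth_field_on U Z \<longrightarrow>
        (\<forall>x\<in>U. dir_deriv X (eval_bilin g Y Z) x =
           eval_bilin g (nabla X Y) Z x + eval_bilin g Y (nabla X Z) x))"

definition curvature :: "'n::finite connection \<Rightarrow>
    'n vector_field \<Rightarrow> 'n vector_field \<Rightarrow> 'n vector_field \<Rightarrow> 'n vector_field" where
  "curvature nabla X Y Z =
     (\<lambda>x. nabla X (nabla Y Z) x - nabla Y (nabla X Z) x - nabla (lie_bracket X Y) Z x)"

text \<open>Here \<open>E\<close> is meant to be an orthonormal frame for \<open>g\<close> and \<open>nabla\<close> its Levi-Civita connection.\<close>

definition ricci :: "'n::finite bilinear_field \<Rightarrow> 'n connection \<Rightarrow> ('n \<Rightarrow> 'n vector_field) \<Rightarrow>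
    'n vector_field \<Rightarrow> 'n vector_field \<Rightarrow> 'n scalar_field" where
  "ricci g nabla E Y Z = (\<lambda>x. \<Sum>k\<in>UNIV. eval_bilin g (curvature nabla (E k) Y Z) (E k) x)"

definition almost_eta_ricci_soliton :: "(real ^ 'n::finite) set \<Rightarrow> 'n bilinear_field \<Rightarrow>
    'n connection \<Rightarrow> ('n \<Rightarrow> 'n vector_field) \<Rightarrow>
    'n vector_field \<Rightarrow> 'n one_form \<Rightarrow> 'n scalar_field \<Rightarrow> 'n scalar_field \<Rightarrow> bool" where
  "almost_eta_ricci_soliton U g nabla E V \<eta> lam \<mu> \<longleftrightarrow>
     smooth_field_on U V \<and> smooth_one_form_on U \<eta> \<and>
     smooth_fun_on U lam \<and> smooth_fun_on U \<mu> \<and> (\<exists>x\<in>U. \<mu> x \<noteq> 0) \<and>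
     (\<forall>X Y. smooth_field_on U X \<longrightarrow> smooth_field_on U Y \<longrightarrow>
        (\<forall>x\<in>U. 1 / 2 * lie_deriv_bilin V g X Y x + ricci g nabla E X Y x
           + lam x * eval_bilin g X Y x + \<mu> x * (eval_form \<eta> X x * eval_form \<eta> Y x) = 0))"

definition product_box :: "real set \<Rightarrow> real set \<Rightarrow> real set \<Rightarrow> (real ^ 3) set" where
  "product_box I1 I2 I3 = {x. x $ 1 \<in> I1 \<and> x $ 2 \<in> I2 \<and> x $ 3 \<in> I3}"

definition diag_metric :: "3 scalar_field \<Rightarrow> 3 scalar_field \<Rightarrow> 3 bilinear_field" where
  "diag_metric f1 f2 = (\<lambda>x v w.
     1 / (f1 x)\<^sup>2 * (v $ 1 * w $ 1) + 1 / (f2 x)\<^sup>2 * (v $ 2 * w $ 2) + v $ 3 * w $ 3)"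

definition diag_frame :: "3 scalar_field \<Rightarrow> 3 scalar_field \<Rightarrow> 3 \<Rightarrow> 3 vector_field" where
  "diag_frame f1 f2 k = (\<lambda>x.
     if k = 1 then f1 x *\<^sub>R coord_field 1 x
     else if k = 2 then f2 x *\<^sub>R coord_field 2 x
     else coord_field 3 x)"

definition dual_coframe_on ::
  "(real ^ 'n::finite) set \<Rightarrow> ('n \<Rightarrow> 'n vector_field) \<Rightarrow> ('n \<Rightarrow> 'n one_form) \<Rightarrow> bool" where
  "dual_coframe_on U E e \<longleftrightarrow>
     (\<forall>x\<in>U. \<forall>k. linear (e k x) \<and> (\<forall>l. e k x (E l x) = (if k = l then 1 else 0)))"

end

theory Submission
  imports Defs
begin

text \<open>
  The field \<open>\<partial>\<^sub>3\<close> is parallel, so \<open>\<pounds>\<^sub>V g = 0\<close> and \<open>Ric(\<partial>\<^sub>i, \<partial>\<^sub>3) = 0\<close>. The \<open>(1,3)\<close> component of the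
  soliton equation is then \<open>\<mu> f\<^sup>2 / f\<^sub>1 = 0\<close>, whence \<open>\<eta> = 0\<close>; the \<open>(3,3)\<close> component gives \<open>\<lambda> = 0\<close>; and
  the \<open>(1,1)\<close> component becomes \<open>Ric(\<partial>\<^sub>1, \<partial>\<^sub>1) = f\<^sub>2 / f\<^sub>1 \<cdot> (f\<^sub>2 f\<^sub>1' / f\<^sub>1\<^sup>2)' = 0\<close>. Hence
  \<open>f\<^sub>2 f\<^sub>1' / f\<^sub>1\<^sup>2\<close> is constant on the convex set \<open>I\<close>; the alternative is whether this constant
  vanishes. All computations use the coordinate fields, whose brackets vanish, so that the
  Koszul formula reduces to the Christoffel symbols.
\<close>

section \<open>Smooth functions and directional derivatives\<close>

lemma has_derivative_dir_deriv:
  assumes "h differentiable (at x)"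
  shows "(h has_derivative (\<lambda>v. dir_deriv (\<lambda>_. v) h x)) (at x)"
  using assms by (simp add: dir_deriv_def frechet_derivative_works[symmetric])

lemma dir_deriv_eqI:
  assumes "(h has_derivative h') (at x)"
  shows "dir_deriv X h x = h' (X x)"
  using frechet_derivative_at[OF assms] by (simp add: dir_deriv_def)

lemma partial_deriv_eqI:
  assumes "(h has_derivative h') (at x)"
  shows "partial_deriv i h x = h' (axis i 1)"
  using dir_deriv_eqI[OF assms, of "coord_field i"] by (simp add: partial_deriv_def coord_field_def)

text \<open>Near an interior point both functions have the same derivatives, and
  \<open>frechet_derivative\<close> chooses from this set of derivatives. Hence the choices agree
  even if neither function is differentiable at \<open>x\<close>.\<close>

lemma dir_deriv_cong:
  assumes "open U" "x \<in> U" "\<And>y. y \<in> U \<Longrightarrow> h y = k y"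
  shows "dir_deriv X h x = dir_deriv X k x"
proof -
  have "(h has_derivative D) (at x) \<longleftrightarrow> (k has_derivative D) (at x)" for D
    using has_derivative_transform_within_open[of h D x UNIV U k]
      has_derivative_transform_within_open[of k D x UNIV U h] assms by auto
  then show ?thesis
    by (simp add: dir_deriv_def frechet_derivative_def)
qed

lemma partial_deriv_cong:
  assumes "open U" "x \<in> U" "\<And>y. y \<in> U \<Longrightarrow> h y = k y"
  shows "partial_deriv i h x = partial_deriv i k x"
  unfolding partial_deriv_def by (rule dir_deriv_cong[OF assms])

lemma dir_deriv_const [simp]: "dir_deriv X (\<lambda>y. c) = (\<lambda>x. 0)"
  by (simp add: dir_deriv_def)

lemma partial_deriv_const [simp]: "partial_deriv i (\<lambda>y. c) = (\<lambda>x. 0)"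
  by (simp add: partial_deriv_def)

lemma coord_field_component: "coord_field i x $ j = (if j = i then 1 else 0)"
  by (simp add: coord_field_def axis_def)

text \<open>Fields are total functions of which only the values on \<open>U\<close> are controlled,
  so regularity has to be transferable along equality on \<open>U\<close>. Openness passes that
  equality on to the partial derivatives, which drives the induction.\<close>

lemma Ck_on_cong:
  assumes "open U" "\<And>x. x \<in> U \<Longrightarrow> h x = h' x" "Ck_on k U h"
  shows "Ck_on k U h'"
  using assms(2,3)
proof (induction k arbitrary: h h')
  case 0
  then show ?case by (metis Ck_on.simps(1) continuous_on_cong)
next
  case (Suc k)
  have "h' differentiable_on U"
    using Suc.prems by (auto simp: differentiable_on_def
        intro: differentiable_transform_within[OF _ zero_less_one])
  moreover have "Ck_on k U (partial_deriv i h')" for i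
  proof (rule Suc.IH)
    show "Ck_on k U (partial_deriv i h)" using Suc.prems by simp
    show "partial_deriv i h x = partial_deriv i h' x" if "x \<in> U" for x
      using that Suc.prems(1) by (rule partial_deriv_cong[OF \<open>open U\<close>])
  qed
  ultimately show ?case by simp
qed

lemma Ck_on_const: "Ck_on k U (\<lambda>x. c)"
  by (induction k arbitrary: c) (simp_all add: partial_deriv_def)

lemma Ck_on_SucD: "Ck_on (Suc k) U h \<Longrightarrow> Ck_on k U h"
  by (induction k arbitrary: h) (auto intro: differentiable_imp_continuous_on)

lemma partial_deriv_add:
  assumes "h differentiable (at x)" "k differentiable (at x)"
  shows "partial_deriv i (\<lambda>x. h x + k x) x = partial_deriv i h x + partial_deriv i k x"
  by (rule trans[OF partial_deriv_eqI])
    (use assms in \<open>auto simp: partial_deriv_def dir_deriv_def coord_field_def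
      intro!: derivative_eq_intros has_derivative_dir_deriv\<close>)

lemma partial_deriv_mult:
  assumes "h differentiable (at x)" "k differentiable (at x)"
  shows "partial_deriv i (\<lambda>x. h x * k x) x = h x * partial_deriv i k x + partial_deriv i h x * k x"
  by (rule trans[OF partial_deriv_eqI])
    (use assms in \<open>auto simp: partial_deriv_def dir_deriv_def coord_field_def
      intro!: derivative_eq_intros has_derivative_dir_deriv\<close>)

lemma Ck_on_add:
  assumes "open U" "Ck_on k U h" "Ck_on k U h'"
  shows "Ck_on k U (\<lambda>x. h x + h' x)"
  using assms(2,3)
proof (induction k arbitrary: h h')
  case 0
  then show ?case by (simp add: continuous_on_add)
next
  case (Suc k)
  have "Ck_on k U (partial_deriv i (\<lambda>x. h x + h' x))" for i
    by (rule Ck_on_cong[OF \<open>open U\<close> _ Suc.IH, of "partial_deriv i h" "partial_deriv i h'"])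
      (use Suc.prems \<open>open U\<close> in \<open>auto simp: partial_deriv_add differentiable_on_eq_differentiable_at\<close>)
  then show ?case using Suc.prems by (simp add: differentiable_on_def)
qed

text \<open>The product rule yields products of one partial derivative and one undifferentiated
  factor; lowering the latter by one order with \<open>Ck_on_SucD\<close> brings both products under
  the induction hypothesis.\<close>

lemma Ck_on_mult:
  assumes "open U" "Ck_on k U h" "Ck_on k U h'"
  shows "Ck_on k U (\<lambda>x. h x * h' x)"
  using assms(2,3)
proof (induction k arbitrary: h h')
  case 0
  then show ?case by (simp add: continuous_on_mult)
next
  case (Suc k)
  have 1: "Ck_on k U h" "Ck_on k U h'"
    using Suc.prems by (simp_all only: Ck_on_SucD)
  have 2: "h x * partial_deriv i h' x + partial_deriv i h x * h' x
      = partial_deriv i (\<lambda>x. h x * h' x) x" if "x \<in> U" for i x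
    using that Suc.prems \<open>open U\<close>
    by (simp add: partial_deriv_mult differentiable_on_eq_differentiable_at)
  have "Ck_on k U (partial_deriv i (\<lambda>x. h x * h' x))" for i
    by (rule Ck_on_cong[OF \<open>open U\<close> 2 Ck_on_add[OF \<open>open U\<close> Suc.IH Suc.IH]])
      (use 1 Suc.prems in simp_all)
  then show ?case using Suc.prems by (simp add: differentiable_on_def)
qed

lemma smooth_fun_on_const: "smooth_fun_on U (\<lambda>x. c)"
  by (simp add: smooth_fun_on_def Ck_on_const)

lemma smooth_fun_on_mult:
  "open U \<Longrightarrow> smooth_fun_on U h \<Longrightarrow> smooth_fun_on U k \<Longrightarrow> smooth_fun_on U (\<lambda>x. h x * k x)"
  by (simp add: smooth_fun_on_def Ck_on_mult)

lemma smooth_fun_on_uminus: "open U \<Longrightarrow> smooth_fun_on U h \<Longrightarrow> smooth_fun_on U (\<lambda>x. - h x)"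
  using smooth_fun_on_mult[OF _ smooth_fun_on_const[of _ "-1"]] by simp

lemma smooth_fun_on_partial_deriv: "smooth_fun_on U h \<Longrightarrow> smooth_fun_on U (partial_deriv i h)"
  unfolding smooth_fun_on_def by (metis Ck_on.simps(2))

lemma smooth_fun_on_differentiable:
  "smooth_fun_on U h \<Longrightarrow> open U \<Longrightarrow> x \<in> U \<Longrightarrow> h differentiable (at x)"
  unfolding smooth_fun_on_def
  by (metis Ck_on.simps(2) differentiable_on_eq_differentiable_at)

section \<open>Smooth vector fields and their Lie brackets\<close>

lemma smooth_field_on_cong:
  assumes "open U" "\<And>x. x \<in> U \<Longrightarrow> X x = Y x" "smooth_field_on U X"
  shows "smooth_field_on U Y"
  unfolding smooth_field_on_def smooth_fun_on_def
proof (intro allI)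
  fix i k
  show "Ck_on k U (\<lambda>x. Y x $ i)"
    by (rule Ck_on_cong[OF \<open>open U\<close>, of "\<lambda>x. X x $ i"])
      (use assms(2,3) in \<open>auto simp: smooth_field_on_def smooth_fun_on_def\<close>)
qed

lemma smooth_field_on_const: "smooth_field_on U (\<lambda>x. v)"
  by (simp add: smooth_field_on_def smooth_fun_on_const)

lemma smooth_field_on_coord_field: "smooth_field_on U (coord_field i)"
  by (simp add: coord_field_def smooth_field_on_const)

lemma smooth_field_on_scaleR:
  "open U \<Longrightarrow> smooth_fun_on U h \<Longrightarrow> smooth_field_on U X \<Longrightarrow> smooth_field_on U (\<lambda>x. h x *\<^sub>R X x)"
  by (simp add: smooth_field_on_def smooth_fun_on_mult)

lemma lie_bracket_coord_field [simp]: "lie_bracket (coord_field i) (coord_field j) = (\<lambda>x. 0)"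
  by (simp add: lie_bracket_def coord_field_def vec_eq_iff fun_eq_iff)

text \<open>The coefficients of both coordinate fields are constant, so only the second term of the
  bracket survives, where \<open>h\<close> is differentiated along the \<open>i\<close>-th
  direction.\<close>

lemma lie_bracket_scaleR_coord_field:
  assumes "h differentiable (at x)"
  shows "lie_bracket (\<lambda>x. h x *\<^sub>R coord_field k x) (coord_field i) x
    = (- partial_deriv i h x) *\<^sub>R coord_field k x"
proof -
  have "partial_deriv i (\<lambda>x. h x * c) x = partial_deriv i h x * c" for c
    using partial_deriv_mult[OF assms, of "\<lambda>_. c"] by (simp add: partial_deriv_def)
  then show ?thesis
    by (simp add: lie_bracket_def vec_eq_iff coord_field_def partial_deriv_def[unfolded coord_field_def])
qed

section \<open>Levi-Civita connections in coordinates\<close>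

locale levi_civita_connection =
  fixes U :: "(real ^ 'n::finite) set" and g :: "'n bilinear_field" and nabla :: "'n connection"
  assumes open_U: "open U"
    and levi_civita: "levi_civita_on U g nabla"
    and g_sym: "x \<in> U \<Longrightarrow> g x v w = g x w v"
    and g_linear: "x \<in> U \<Longrightarrow> linear (\<lambda>v. g x v w)"
begin

lemma affine: "affine_connection_on U nabla"
  using levi_civita by (simp add: levi_civita_on_def)

lemmas affine' = affine[unfolded affine_connection_on_def]
lemmas levi_civita' = levi_civita[unfolded levi_civita_on_def]

lemma smooth_nabla: "smooth_field_on U X \<Longrightarrow> smooth_field_on U Y \<Longrightarrow> smooth_field_on U (nabla X Y)"
  using affine'[THEN conjunct1] by blast

lemma nabla_cong:
  assumes "smooth_field_on U X" "smooth_field_on U X'" "smooth_field_on U Y" "smooth_field_on U Y'"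
    and "\<And>x. x \<in> U \<Longrightarrow> X x = X' x" "\<And>x. x \<in> U \<Longrightarrow> Y x = Y' x" "x \<in> U"
  shows "nabla X Y x = nabla X' Y' x"
  using affine'[THEN conjunct2, THEN conjunct1, rule_format, OF assms(1-4)] assms(5-) by simp

lemma nabla_scale_left:
  "smooth_fun_on U h \<Longrightarrow> smooth_field_on U X \<Longrightarrow> smooth_field_on U Y \<Longrightarrow> x \<in> U \<Longrightarrow>
    nabla (\<lambda>y. h y *\<^sub>R X y) Y x = h x *\<^sub>R nabla X Y x"
  using affine'[THEN conjunct2, THEN conjunct2, THEN conjunct2, THEN conjunct1] by simp

lemma nabla_scale_right:
  "smooth_fun_on U h \<Longrightarrow> smooth_field_on U X \<Longrightarrow> smooth_field_on U Y \<Longrightarrow> x \<in> U \<Longrightarrow>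
    nabla X (\<lambda>y. h y *\<^sub>R Y y) x = h x *\<^sub>R nabla X Y x + dir_deriv X h x *\<^sub>R Y x"
  using affine'[THEN conjunct2, THEN conjunct2, THEN conjunct2, THEN conjunct2, THEN conjunct2]
  by simp

lemma nabla_torsion_free:
  "smooth_field_on U X \<Longrightarrow> smooth_field_on U Y \<Longrightarrow> x \<in> U \<Longrightarrow>
    nabla X Y x - nabla Y X x = lie_bracket X Y x"
  using levi_civita'[THEN conjunct2, THEN conjunct1] by simp

lemma nabla_metric:
  "smooth_field_on U X \<Longrightarrow> smooth_field_on U Y \<Longrightarrow> smooth_field_on U Z \<Longrightarrow> x \<in> U \<Longrightarrow>
    dir_deriv X (eval_bilin g Y Z) x = g x (nabla X Y x) (Z x) + g x (Y x) (nabla X Z x)"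
  using levi_civita'[THEN conjunct2, THEN conjunct2] by (simp add: eval_bilin_def)

lemma nabla_zero_left:
  assumes "smooth_field_on U Y" "x \<in> U"
  shows "nabla (\<lambda>y. 0) Y x = 0"
  using nabla_scale_left[OF smooth_fun_on_const[of U 0] smooth_field_on_const assms] by simp

text \<open>A covariant derivative may vanish on \<open>U\<close> without being the zero function.
  Replacing it by the zero field on \<open>U\<close> reduces the claim to the Leibniz rule with
  coefficient 0.\<close>

lemma nabla_zero_right:
  assumes "smooth_field_on U X" "smooth_field_on U Y" "\<And>y. y \<in> U \<Longrightarrow> Y y = 0" "x \<in> U"
  shows "nabla X Y x = 0"
proof -
  have "nabla X Y x = nabla X (\<lambda>y. 0) x"
    by (rule nabla_cong[OF assms(1,1,2) smooth_field_on_const refl assms(3,4)])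
  also have "\<dots> = 0"
    using nabla_scale_right[OF smooth_fun_on_const[of U 0] assms(1) smooth_field_on_const assms(4)]
    by simp
  finally show ?thesis .
qed

section \<open>Christoffel symbols, curvature and Ricci tensor in coordinate fields\<close>

abbreviation coord (\<open>\<partial>\<close>) where "\<partial> \<equiv> coord_field"

lemmas smooth_coord = smooth_field_on_coord_field[of U]
lemmas smooth_nabla_coord = smooth_nabla[OF smooth_coord smooth_coord]

lemma nabla_coord_commute: "x \<in> U \<Longrightarrow> nabla (\<partial> i) (\<partial> j) x = nabla (\<partial> j) (\<partial> i) x"
  using nabla_torsion_free[OF smooth_coord smooth_coord, of x i j] by simp

text \<open>Metric compatibility expands the three derivatives into six terms. Vanishing torsion and
  brackets together with the symmetry of \<open>g\<close> make two of them equal and cancel the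
  other four in pairs.\<close>

lemma koszul_coord:
  assumes "x \<in> U"
  shows "2 * g x (nabla (\<partial> i) (\<partial> j) x) (\<partial> k x) =
    partial_deriv i (eval_bilin g (\<partial> j) (\<partial> k)) x + partial_deriv j (eval_bilin g (\<partial> i) (\<partial> k)) x
    - partial_deriv k (eval_bilin g (\<partial> i) (\<partial> j)) x"
  unfolding partial_deriv_def nabla_metric[OF smooth_coord smooth_coord smooth_coord assms]
  using assms by (simp add: g_sym[of x "\<partial> _ x"] nabla_coord_commute[of x j i]
      nabla_coord_commute[of x k])

text \<open>Metric compatibility trades each second covariant derivative for a partial derivative of
  \<open>g\<close> applied to a first one, and the bracket term is zero. Christoffel symbols
  therefore suffice to evaluate the right side.\<close>

lemma curvature_coord:
  assumes "x \<in> U"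
  shows "g x (curvature nabla (\<partial> i) (\<partial> j) (\<partial> k) x) (\<partial> l x) =
      partial_deriv i (\<lambda>y. g y (nabla (\<partial> j) (\<partial> k) y) (\<partial> l y)) x
    - g x (nabla (\<partial> j) (\<partial> k) x) (nabla (\<partial> i) (\<partial> l) x)
    - partial_deriv j (\<lambda>y. g y (nabla (\<partial> i) (\<partial> k) y) (\<partial> l y)) x
    + g x (nabla (\<partial> i) (\<partial> k) x) (nabla (\<partial> j) (\<partial> l) x)"
proof -
  have "partial_deriv a (\<lambda>y. g y (nabla (\<partial> b) (\<partial> k) y) (\<partial> l y)) x
    = g x (nabla (\<partial> a) (nabla (\<partial> b) (\<partial> k)) x) (\<partial> l x)
    + g x (nabla (\<partial> b) (\<partial> k) x) (nabla (\<partial> a) (\<partial> l) x)" for a b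
    using nabla_metric[OF smooth_coord smooth_nabla_coord smooth_coord assms]
    by (simp add: partial_deriv_def eval_bilin_def)
  then show ?thesis
    using assms by (simp add: curvature_def nabla_zero_left[OF smooth_coord] linear_diff[OF g_linear])
qed

text \<open>Tensoriality in the first slot: the Leibniz term in which \<open>h\<close> is
  differentiated cancels against the bracket term. It lets the trace over a rescaled coordinate
  frame be computed with coordinate fields.\<close>

lemma curvature_scale_coord:
  assumes h: "smooth_fun_on U h" and x: "x \<in> U"
  shows "curvature nabla (\<lambda>y. h y *\<^sub>R \<partial> k y) (\<partial> i) (\<partial> j) x
    = h x *\<^sub>R curvature nabla (\<partial> k) (\<partial> i) (\<partial> j) x"
proof -
  let ?X = "\<lambda>y. h y *\<^sub>R \<partial> k y"
  let ?h' = "\<lambda>y. - partial_deriv i h y"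
  have X: "smooth_field_on U ?X"
    by (intro smooth_field_on_scaleR open_U h smooth_coord)
  have h': "smooth_fun_on U ?h'"
    by (intro smooth_fun_on_uminus smooth_fun_on_partial_deriv open_U h)
  have bracket: "lie_bracket ?X (\<partial> i) y = ?h' y *\<^sub>R \<partial> k y" if "y \<in> U" for y
    using that by (intro lie_bracket_scaleR_coord_field smooth_fun_on_differentiable[OF h open_U])
  have 1: "nabla ?X (nabla (\<partial> i) (\<partial> j)) x = h x *\<^sub>R nabla (\<partial> k) (nabla (\<partial> i) (\<partial> j)) x"
    by (rule nabla_scale_left[OF h smooth_coord smooth_nabla_coord x])
  have "nabla (\<partial> i) (nabla ?X (\<partial> j)) x = nabla (\<partial> i) (\<lambda>y. h y *\<^sub>R nabla (\<partial> k) (\<partial> j) y) x"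
    by (rule nabla_cong) (auto intro!: smooth_coord smooth_nabla X x h open_U
        smooth_field_on_scaleR nabla_scale_left)
  also have "\<dots> = h x *\<^sub>R nabla (\<partial> i) (nabla (\<partial> k) (\<partial> j)) x
      + partial_deriv i h x *\<^sub>R nabla (\<partial> k) (\<partial> j) x"
    unfolding partial_deriv_def by (rule nabla_scale_right[OF h smooth_coord smooth_nabla_coord x])
  finally have 2: "nabla (\<partial> i) (nabla ?X (\<partial> j)) x = \<dots>" .
  have h'X: "smooth_field_on U (\<lambda>y. ?h' y *\<^sub>R \<partial> k y)"
    by (rule smooth_field_on_scaleR[OF open_U h' smooth_coord])
  \<comment> \<open>The formula for the bracket holds on \<open>U\<close> only, so the smoothness of
    the bracket is inherited from the explicit field before the two are exchanged under
    \<open>nabla\<close>.\<close>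
  have "nabla (lie_bracket ?X (\<partial> i)) (\<partial> j) x = nabla (\<lambda>y. ?h' y *\<^sub>R \<partial> k y) (\<partial> j) x"
    by (rule nabla_cong[OF smooth_field_on_cong[OF open_U bracket[symmetric] h'X] h'X
          smooth_coord smooth_coord bracket refl x])
  also have "\<dots> = ?h' x *\<^sub>R nabla (\<partial> k) (\<partial> j) x"
    by (rule nabla_scale_left[OF h' smooth_coord smooth_coord x])
  finally have 3: "nabla (lie_bracket ?X (\<partial> i)) (\<partial> j) x = \<dots>" .
  show ?thesis
    unfolding curvature_def 1 2 3 lie_bracket_coord_field nabla_zero_left[OF smooth_coord x]
    by (simp add: scaleR_diff_right)
qed

text \<open>Each coefficient occurs twice in the trace, in the first slot of the curvature and in
  the second slot of \<open>g\<close>, hence the square.\<close>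

lemma ricci_coord:
  assumes \<phi>: "\<And>k. smooth_fun_on U (\<phi> k)" and x: "x \<in> U"
  shows "ricci g nabla (\<lambda>k y. \<phi> k y *\<^sub>R \<partial> k y) (\<partial> i) (\<partial> j) x
    = (\<Sum>k\<in>UNIV. (\<phi> k x)\<^sup>2 * g x (curvature nabla (\<partial> k) (\<partial> i) (\<partial> j) x) (\<partial> k x))"
proof -
  have "g x (a *\<^sub>R v) (a *\<^sub>R w) = a\<^sup>2 * g x v w" for a v w
    using linear_scale[OF g_linear[OF x]] g_sym[OF x] by (metis power2_eq_square mult.assoc real_scaleR_def)
  then show ?thesis
    by (simp add: ricci_def eval_bilin_def curvature_scale_coord[OF \<phi> x])
qed

end

section \<open>Functions of a single coordinate\<close>

lemma has_derivative_translate: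
  fixes h :: "'a::real_normed_vector \<Rightarrow> 'b::real_normed_vector"
  assumes "(h has_derivative D) (at (x + a))"
  shows "((\<lambda>z. h (z + a)) has_derivative D) (at x)"
proof -
  have "((\<lambda>z. z + a) has_derivative (\<lambda>z. z)) (at x)"
    by (auto intro!: derivative_eq_intros)
  from has_derivative_compose[OF this assms] show ?thesis .
qed

definition depends_only_on :: "'n::finite \<Rightarrow> (real ^ 'n) set \<Rightarrow> 'n scalar_field \<Rightarrow> bool" where
  "depends_only_on j U h \<longleftrightarrow> (\<forall>x\<in>U. \<forall>y\<in>U. x $ j = y $ j \<longrightarrow> h x = h y)"

text \<open>Translation by \<open>y - x\<close> keeps the \<open>j\<close>-th coordinate and thus
  preserves \<open>h\<close> near \<open>x\<close>, so \<open>h\<close> has the same derivatives at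
  \<open>x\<close> and at \<open>y\<close>.\<close>

lemma depends_only_on_partial_deriv:
  assumes U: "open U" and h: "depends_only_on j U h"
  shows "depends_only_on j U (partial_deriv i h)"
  unfolding depends_only_on_def
proof (intro ballI impI)
  have transport: "(h has_derivative D) (at x)"
    if xy: "x \<in> U" "y \<in> U" "x $ j = y $ j" and D: "(h has_derivative D) (at y)" for x y D
  proof (rule has_derivative_transform_within_open)
    show "((\<lambda>z. h (z + (y - x))) has_derivative D) (at x)"
      using has_derivative_translate[of h D x "y - x"] D by simp
    \<comment> \<open>Both \<open>z\<close> and its translate must lie in \<open>U\<close> for their
      values under \<open>h\<close> to be comparable.\<close>
    show "open (U \<inter> (\<lambda>z. z + (y - x)) -` U)"
      using U by (intro open_Int open_vimage continuous_intros)
    show "h (z + (y - x)) = h z" if "z \<in> U \<inter> (\<lambda>z. z + (y - x)) -` U" for z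
      using that h xy(3) by (auto simp: depends_only_on_def)
  qed (use xy in auto)
  fix x y assume "x \<in> U" "y \<in> U" "x $ j = y $ j"
  then have "(h has_derivative D) (at x) \<longleftrightarrow> (h has_derivative D) (at y)" for D
    using transport by metis
  then show "partial_deriv i h x = partial_deriv i h y"
    by (simp add: partial_deriv_def dir_deriv_def frechet_derivative_def coord_field_def)
qed

lemma has_derivative_depends_only_on:
  assumes U: "open U" and h: "depends_only_on j U h" and x: "x \<in> U" and diff: "h differentiable (at x)"
  shows "(h has_derivative (\<lambda>v. v $ j * partial_deriv j h x)) (at x)"
proof -
  obtain D where D: "(h has_derivative D) (at x)"
    using diff by (auto simp: differentiable_def)
  interpret D: bounded_linear D
    using D by (rule has_derivative_bounded_linear)
  \<comment> \<open>Along a line with such a direction \<open>h\<close> is constant near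
    \<open>x\<close>. Two derivatives of its restriction at 0 are compared by uniqueness and
    evaluated at 1.\<close>
  have zero: "D v = 0" if v: "v $ j = 0" for v
  proof -
    have "((\<lambda>t. x + t *\<^sub>R v) has_derivative (\<lambda>t. t *\<^sub>R v)) (at 0)"
      by (auto intro!: derivative_eq_intros)
    from has_derivative_compose[OF this, of h D]
    have "((\<lambda>t. h (x + t *\<^sub>R v)) has_derivative (\<lambda>t. D (t *\<^sub>R v))) (at 0)"
      using D by simp
    moreover have "((\<lambda>t. h (x + t *\<^sub>R v)) has_derivative (\<lambda>t. 0)) (at 0)"
    proof (rule has_derivative_transform_within_open)
      show "((\<lambda>t. h x) has_derivative (\<lambda>t. 0)) (at (0::real))" by simp
      show "open ((\<lambda>t. x + t *\<^sub>R v) -` U)"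
        using U by (intro open_vimage continuous_intros)
      show "h x = h (x + t *\<^sub>R v)" if "t \<in> (\<lambda>t. x + t *\<^sub>R v) -` U" for t
        using h[unfolded depends_only_on_def, rule_format, OF x, of "x + t *\<^sub>R v"] that v by simp
    qed (use x in simp)
    ultimately have "(\<lambda>t. D (t *\<^sub>R v)) = (\<lambda>t. 0)"
      by (rule has_derivative_unique)
    then show ?thesis
      by (metis scaleR_one)
  qed
  have "D v = v $ j * D (axis j 1)" for v
  proof -
    have "D (v - (v $ j) *\<^sub>R axis j 1) = 0"
      by (rule zero) simp
    then show ?thesis
      by (simp add: D.diff D.scaleR)
  qed
  then have "D = (\<lambda>v. v $ j * partial_deriv j h x)"
    unfolding partial_deriv_eqI[OF D] by (rule ext)
  with D show ?thesis by simp
qed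

section \<open>The diagonal metric\<close>

text \<open>Pairing with coordinate fields recovers the components of a vector. The point
  \<open>y\<close> is free because coordinate fields are constant.\<close>

lemma diag_metric_coord_field:
  "diag_metric f1 f2 x v (coord_field 1 y) = 1 / (f1 x)\<^sup>2 * v $ 1"
  "diag_metric f1 f2 x v (coord_field 2 y) = 1 / (f2 x)\<^sup>2 * v $ 2"
  "diag_metric f1 f2 x v (coord_field 3 y) = v $ 3"
  by (simp_all add: diag_metric_def coord_field_def axis_def)

lemma eval_bilin_diag_metric:
  "eval_bilin (diag_metric f1 f2) (coord_field i) (coord_field j) =
    (if i \<noteq> j then (\<lambda>x. 0) else if i = 1 then (\<lambda>x. 1 / (f1 x)\<^sup>2)
     else if i = 2 then (\<lambda>x. 1 / (f2 x)\<^sup>2) else (\<lambda>x. 1))"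
  using exhaust_3[of i] exhaust_3[of j]
  by (auto simp: eval_bilin_def diag_metric_def coord_field_def axis_def)

locale diag_levi_civita =
  fixes U :: "(real ^ 3) set" and f1 f2 :: "real ^ 3 \<Rightarrow> real" and nabla :: "3 connection"
  assumes open_domain: "open U"
    and smooth: "smooth_fun_on U f1" "smooth_fun_on U f2"
    and nonzero: "x \<in> U \<Longrightarrow> f1 x \<noteq> 0" "x \<in> U \<Longrightarrow> f2 x \<noteq> 0"
    and depends: "depends_only_on 2 U f1" "depends_only_on 2 U f2"
    and levi_civita_diag: "levi_civita_on U (diag_metric f1 f2) nabla"

sublocale diag_levi_civita \<subseteq> levi_civita_connection U "diag_metric f1 f2" nabla
proof unfold_locales
  show "levi_civita_on U (diag_metric f1 f2) nabla"
    by (rule levi_civita_diag)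
qed (auto simp: open_domain diag_metric_def algebra_simps linear_iff add_divide_distrib)

context diag_levi_civita
begin

abbreviation "f1' \<equiv> partial_deriv 2 f1"
abbreviation "f2' \<equiv> partial_deriv 2 f2"

lemma has_derivative_x2:
  assumes "smooth_fun_on U h" "depends_only_on 2 U h" "x \<in> U"
  shows "(h has_derivative (\<lambda>v. v $ 2 * partial_deriv 2 h x)) (at x)"
  using assms by (intro has_derivative_depends_only_on[OF open_U] smooth_fun_on_differentiable[OF _ open_U])

text \<open>These are the functions differentiated in the Ricci computation: \<open>f1\<close>
  twice, \<open>f2\<close> once.\<close>

lemmas has_derivative_f [derivative_intros] =
  has_derivative_x2[OF smooth(1) depends(1)]
  has_derivative_x2[OF smooth(2) depends(2)]
  has_derivative_x2[OF smooth_fun_on_partial_deriv[OF smooth(1)]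
    depends_only_on_partial_deriv[OF open_U depends(1)]]

lemma partial_deriv_metric:
  assumes "smooth_fun_on U h" "depends_only_on 2 U h" "x \<in> U" "h x \<noteq> 0"
  shows "partial_deriv i (\<lambda>x. 1 / (h x)\<^sup>2) x
    = (if i = 2 then - 2 * partial_deriv 2 h x / (h x) ^ 3 else 0)"
proof -
  have "((\<lambda>y. 1 / y\<^sup>2) has_real_derivative - 2 / (h x) ^ 3) (at (h x))"
    using assms(4) by (auto intro!: derivative_eq_intros simp: field_simps eval_nat_numeral)
  from partial_deriv_eqI[OF DERIV_compose_FDERIV[OF this has_derivative_x2[OF assms(1-3)]], of i]
  show ?thesis
    by (simp add: axis_def)
qed

section \<open>Christoffel symbols of the diagonal metric\<close>

lemma partial_deriv_diag_metric:
  assumes "x \<in> U"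
  shows "partial_deriv k (eval_bilin (diag_metric f1 f2) (\<partial> i) (\<partial> j)) x =
    (if k \<noteq> 2 \<or> i \<noteq> j \<or> i = 3 then 0
     else if i = 1 then - 2 * f1' x / (f1 x) ^ 3 else - 2 * f2' x / (f2 x) ^ 3)"
  using partial_deriv_metric[OF smooth(1) depends(1) assms nonzero(1)[OF assms], of k]
    partial_deriv_metric[OF smooth(2) depends(2) assms nonzero(2)[OF assms], of k]
    exhaust_3[of i]
  by (auto simp: eval_bilin_diag_metric)

lemma nabla_coord:
  assumes x: "x \<in> U"
  shows "nabla (\<partial> 1) (\<partial> 1) x = ((f2 x)\<^sup>2 * f1' x / (f1 x) ^ 3) *\<^sub>R \<partial> 2 x"
    and "nabla (\<partial> 1) (\<partial> 2) x = - (f1' x / f1 x) *\<^sub>R \<partial> 1 x"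
    and "nabla (\<partial> 2) (\<partial> 1) x = - (f1' x / f1 x) *\<^sub>R \<partial> 1 x"
    and "nabla (\<partial> 2) (\<partial> 2) x = - (f2' x / f2 x) *\<^sub>R \<partial> 2 x"
    and "nabla (\<partial> i) (\<partial> 3) x = 0"
    and "nabla (\<partial> 3) (\<partial> i) x = 0"
proof -
  note koszul = koszul_coord[OF x, of _ _ 1] koszul_coord[OF x, of _ _ 2] koszul_coord[OF x, of _ _ 3]
  let ?g = "\<lambda>i j. eval_bilin (diag_metric f1 f2) (\<partial> i) (\<partial> j)"
  \<comment> \<open>Christoffel symbols of the first kind; the factors
    \<open>(f1 x)\<^sup>2\<close>, \<open>(f2 x)\<^sup>2\<close> and 1 of the inverse metric then
    raise the last index.\<close>
  let ?\<Gamma> = "\<lambda>i j k. (partial_deriv i (?g j k) x + partial_deriv j (?g i k) x - partial_deriv k (?g i j) x) / 2"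
  have "nabla (\<partial> i) (\<partial> j) x $ 1 = (f1 x)\<^sup>2 * ?\<Gamma> i j 1"
    "nabla (\<partial> i) (\<partial> j) x $ 2 = (f2 x)\<^sup>2 * ?\<Gamma> i j 2"
    "nabla (\<partial> i) (\<partial> j) x $ 3 = ?\<Gamma> i j 3" for i j
    using nonzero[OF x] by (simp_all add: koszul[symmetric] diag_metric_coord_field)
  note simps = vec_eq_iff forall_3 this partial_deriv_diag_metric[OF x] coord_field_component
    nonzero[OF x] power2_eq_square power3_eq_cube
  show "nabla (\<partial> 1) (\<partial> 1) x = ((f2 x)\<^sup>2 * f1' x / (f1 x) ^ 3) *\<^sub>R \<partial> 2 x"
    by (simp add: simps)
  show "nabla (\<partial> 1) (\<partial> 2) x = - (f1' x / f1 x) *\<^sub>R \<partial> 1 x"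
    by (simp add: simps)
  then show "nabla (\<partial> 2) (\<partial> 1) x = - (f1' x / f1 x) *\<^sub>R \<partial> 1 x"
    by (simp add: nabla_coord_commute[OF x, of 2])
  show "nabla (\<partial> 2) (\<partial> 2) x = - (f2' x / f2 x) *\<^sub>R \<partial> 2 x"
    by (simp add: simps)
  show "nabla (\<partial> i) (\<partial> 3) x = 0"
    using exhaust_3[of i] by (auto simp: simps)
  then show "nabla (\<partial> 3) (\<partial> i) x = 0"
    by (simp add: nabla_coord_commute[OF x, of 3])
qed

section \<open>Ricci tensor and Lie derivative of the diagonal metric\<close>

lemma ricci_diag_frame:
  assumes x: "x \<in> U"
  shows "ricci (diag_metric f1 f2) nabla (diag_frame f1 f2) (\<partial> i) (\<partial> j) x
    = (f1 x)\<^sup>2 * diag_metric f1 f2 x (curvature nabla (\<partial> 1) (\<partial> i) (\<partial> j) x) (\<partial> 1 x)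
    + (f2 x)\<^sup>2 * diag_metric f1 f2 x (curvature nabla (\<partial> 2) (\<partial> i) (\<partial> j) x) (\<partial> 2 x)
    + diag_metric f1 f2 x (curvature nabla (\<partial> 3) (\<partial> i) (\<partial> j) x) (\<partial> 3 x)"
proof -
  define \<phi> :: "3 \<Rightarrow> 3 scalar_field" where
    "\<phi> k = (if k = 1 then f1 else if k = 2 then f2 else (\<lambda>x. 1))" for k
  have "diag_frame f1 f2 = (\<lambda>k y. \<phi> k y *\<^sub>R \<partial> k y)"
    using exhaust_3 by (force simp: fun_eq_iff diag_frame_def \<phi>_def)
  moreover have "smooth_fun_on U (\<phi> k)" for k
    by (simp add: \<phi>_def smooth smooth_fun_on_const)
  ultimately show ?thesis
    using x by (simp add: ricci_coord sum_3) (simp add: \<phi>_def)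
qed

lemma ricci_coord_3:
  assumes x: "x \<in> U"
  shows "ricci (diag_metric f1 f2) nabla (diag_frame f1 f2) (\<partial> i) (\<partial> 3) x = 0"
proof -
  have "curvature nabla (\<partial> k) (\<partial> i) (\<partial> 3) x = 0" for k
    by (simp add: curvature_def x nabla_zero_left smooth_coord
        nabla_zero_right[OF smooth_coord smooth_nabla_coord nabla_coord(5)])
  then show ?thesis
    unfolding ricci_diag_frame[OF x] by (simp add: diag_metric_def)
qed

text \<open>In the trace, the summand of \<open>\<partial> 1\<close> vanishes since both entries of
  the curvature coincide, and that of \<open>\<partial> 3\<close> because no Christoffel symbol
  involves the index 3. Only the summand of \<open>\<partial> 2\<close> contributes.\<close>

lemma ricci_coord_11:
  assumes x: "x \<in> U"
  shows "ricci (diag_metric f1 f2) nabla (diag_frame f1 f2) (\<partial> 1) (\<partial> 1) x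
    = f2 x / (f1 x) ^ 2 * (f2 x * partial_deriv 2 f1' x / f1 x + f1' x * f2' x / f1 x
      - 2 * f2 x * (f1' x)\<^sup>2 / (f1 x)\<^sup>2)"
proof -
  \<comment> \<open>The factor \<open>(f2 y)\<^sup>2\<close> cancels against the metric coefficient
    of \<open>\<partial> 2\<close>; \<open>f2'\<close> enters only later, through
    \<open>nabla (\<partial> 2) (\<partial> 2)\<close>.\<close>
  have "partial_deriv 2 (\<lambda>y. diag_metric f1 f2 y (nabla (\<partial> 1) (\<partial> 1) y) (\<partial> 2 y)) x
      = partial_deriv 2 (\<lambda>y. f1' y / (f1 y) ^ 3) x"
    by (rule partial_deriv_cong[OF open_U x])
      (simp add: nabla_coord nonzero diag_metric_coord_field coord_field_component)
  also have "\<dots> = partial_deriv 2 f1' x / (f1 x) ^ 3 - 3 * (f1' x)\<^sup>2 / (f1 x) ^ 4"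
  proof (rule trans[OF partial_deriv_eqI])
    show "((\<lambda>y. f1' y / (f1 y) ^ 3) has_derivative
        (\<lambda>v. v $ 2 * (partial_deriv 2 f1' x / (f1 x) ^ 3 - 3 * (f1' x)\<^sup>2 / (f1 x) ^ 4))) (at x)"
      using nonzero[OF x] by (auto intro!: derivative_eq_intros x simp: field_simps eval_nat_numeral)
  qed simp
  finally have 1: "partial_deriv 2 (\<lambda>y. diag_metric f1 f2 y (nabla (\<partial> 1) (\<partial> 1) y) (\<partial> 2 y)) x = \<dots>" .
  \<comment> \<open>The covariant derivative is a multiple of \<open>\<partial> 1\<close>, which is
    orthogonal to \<open>\<partial> 2\<close>.\<close>
  have "partial_deriv 1 (\<lambda>y. diag_metric f1 f2 y (nabla (\<partial> 2) (\<partial> 1) y) (\<partial> 2 y)) x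
      = partial_deriv 1 (\<lambda>y. 0) x"
    by (rule partial_deriv_cong[OF open_U x])
      (simp add: nabla_coord nonzero diag_metric_coord_field coord_field_component)
  then have 2: "partial_deriv 1 (\<lambda>y. diag_metric f1 f2 y (nabla (\<partial> 2) (\<partial> 1) y) (\<partial> 2 y)) x = 0"
    by (simp add: partial_deriv_def)
  have 3: "partial_deriv i (\<lambda>y. diag_metric f1 f2 y (nabla (\<partial> j) (\<partial> 1) y) (\<partial> 3 y)) x = 0"
    if "j \<in> {1, 3}" for i j
  proof -
    have "partial_deriv i (\<lambda>y. diag_metric f1 f2 y (nabla (\<partial> j) (\<partial> 1) y) (\<partial> 3 y)) x
        = partial_deriv i (\<lambda>y. 0) x"
      by (rule partial_deriv_cong[OF open_U x])
        (use that in \<open>auto simp: nabla_coord diag_metric_coord_field coord_field_component\<close>)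
    then show ?thesis by simp
  qed
  have "curvature nabla (\<partial> 1) (\<partial> 1) (\<partial> 1) x = 0"
    by (simp add: curvature_def nabla_zero_left smooth_coord x)
  then show ?thesis
    unfolding ricci_diag_frame[OF x]
    using nonzero[OF x]
    by (simp add: curvature_coord[OF x] 1 2 3 nabla_coord[OF x])
      (simp add: diag_metric_def coord_field_component field_simps eval_nat_numeral)
qed

text \<open>The metric coefficients do not vary with the third coordinate and the brackets vanish,
  so \<open>\<partial> 3\<close> is a Killing field.\<close>

lemma lie_deriv_coord_3:
  assumes x: "x \<in> U"
  shows "lie_deriv_bilin (\<partial> 3) (diag_metric f1 f2) (\<partial> i) (\<partial> j) x = 0"
  using partial_deriv_diag_metric[OF x, of 3 i j]
  by (simp add: lie_deriv_bilin_def partial_deriv_def)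
    (simp add: eval_bilin_def diag_metric_def)

text \<open>The bracketed expression is the one in \<open>ricci_coord_11\<close>, which identifies
  that Ricci component as \<open>f2 x / f1 x\<close> times the derivative of the quotient.\<close>

lemma has_derivative_quotient:
  assumes x: "x \<in> U"
  shows "((\<lambda>y. f2 y * f1' y / (f1 y)\<^sup>2) has_derivative
    (\<lambda>v. v $ 2 * (1 / f1 x * (f2 x * partial_deriv 2 f1' x / f1 x + f1' x * f2' x / f1 x
      - 2 * f2 x * (f1' x)\<^sup>2 / (f1 x)\<^sup>2)))) (at x)"
  using nonzero[OF x] by (auto intro!: derivative_eq_intros x simp: field_simps eval_nat_numeral)

lemma f1_alternative:
  assumes "convex U" and ricci: "\<And>x. x \<in> U \<Longrightarrow>
    ricci (diag_metric f1 f2) nabla (diag_frame f1 f2) (\<partial> 1) (\<partial> 1) x = 0"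
  shows "(\<exists>c. \<forall>x\<in>U. f1 x = c) \<or>
    (\<forall>x\<in>U. f1' x \<noteq> 0) \<and> (\<exists>c. c \<noteq> 0 \<and> (\<forall>x\<in>U. f2 x = c * ((f1 x)\<^sup>2 / f1' x)))"
proof -
  have "((\<lambda>y. f2 y * f1' y / (f1 y)\<^sup>2) has_derivative (\<lambda>v. 0)) (at x within U)" if x: "x \<in> U" for x
  proof -
    have "f2 x * partial_deriv 2 f1' x / f1 x + f1' x * f2' x / f1 x
        - 2 * f2 x * (f1' x)\<^sup>2 / (f1 x)\<^sup>2 = 0"
      using ricci[OF x] nonzero[OF x] unfolding ricci_coord_11[OF x] by simp
    then show ?thesis
      using has_derivative_quotient[OF x] by (simp only: mult_zero_right has_derivative_at_withinI)
  qed
  from has_derivative_zero_constant[OF \<open>convex U\<close> this]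
  obtain c where c: "\<And>x. x \<in> U \<Longrightarrow> f2 x * f1' x / (f1 x)\<^sup>2 = c"
    by blast
  show ?thesis
  proof (cases "c = 0")
    \<comment> \<open>As \<open>f2\<close> has no zeros, \<open>f1'\<close> vanishes, and with it
      the whole derivative of \<open>f1\<close>.\<close>
    case True
    then have "f1' x = 0" if "x \<in> U" for x
      using c[OF that] nonzero[OF that] by simp
    then have "(f1 has_derivative (\<lambda>v. 0)) (at x within U)" if "x \<in> U" for x
      using has_derivative_f(1)[OF that] that by (simp add: has_derivative_at_withinI)
    from has_derivative_zero_constant[OF \<open>convex U\<close> this] show ?thesis ..
  next
    case False
    have "f1' x \<noteq> 0 \<and> f2 x = c * ((f1 x)\<^sup>2 / f1' x)" if "x \<in> U" for x
    proof -
      \<comment> \<open>A zero of \<open>f1'\<close> would make the constant quotient 0.\<close>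
      have "f1' x \<noteq> 0"
        using c[OF that] False by auto
      then show ?thesis
        using c[OF that] nonzero[OF that] by (simp add: field_simps)
    qed
    with False show ?thesis by blast
  qed
qed

end

section \<open>Product boxes, the dual coframe and the soliton equation\<close>

lemma open_product_box:
  assumes "open I1" "open I2" "open I3"
  shows "open (product_box I1 I2 I3)"
proof -
  have "product_box I1 I2 I3 = (\<lambda>x. x $ 1) -` I1 \<inter> (\<lambda>x. x $ 2) -` I2 \<inter> (\<lambda>x. x $ 3) -` I3"
    by (auto simp: product_box_def)
  then show ?thesis
    using assms by (simp add: open_Int open_vimage_vec_nth)
qed

lemma convex_product_box:
  assumes "convex I1" "convex I2" "convex I3"
  shows "convex (product_box I1 I2 I3)"
  using assms by (simp add: convex_def product_box_def)

text \<open>The first frame field is \<open>f1\<close> times \<open>\<partial> 1\<close>, and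
  linearity moves this factor out. The two values serve the (1,3) component of the soliton
  equation.\<close>

lemma dual_coframe_diag_frame:
  assumes "dual_coframe_on U (diag_frame f1 f2) e" "x \<in> U"
  shows "f1 x * e k x (coord_field 1 x) = (if k = 1 then 1 else 0)"
    and "e k x (coord_field 3 x) = (if k = 3 then 1 else 0)"
proof -
  have "linear (e k x)" and e: "\<And>l. e k x (diag_frame f1 f2 l x) = (if k = l then 1 else 0)"
    using assms by (simp_all add: dual_coframe_on_def)
  then show "f1 x * e k x (coord_field 1 x) = (if k = 1 then 1 else 0)"
    using e[of 1] by (simp add: diag_frame_def linear_scale)
  show "e k x (coord_field 3 x) = (if k = 3 then 1 else 0)"
    using e[of 3] by (simp add: diag_frame_def)
qed

theorem proposition3p5:
  fixes I1 I2 I3 :: "real set" and I :: "(real ^ 3) set"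
    and f1 f2 f lam \<mu> :: "real ^ 3 \<Rightarrow> real"
    and g :: "real ^ 3 \<Rightarrow> real ^ 3 \<Rightarrow> real ^ 3 \<Rightarrow> real"
    and E :: "3 \<Rightarrow> real ^ 3 \<Rightarrow> real ^ 3"
    and e :: "3 \<Rightarrow> real ^ 3 \<Rightarrow> real ^ 3 \<Rightarrow> real"
    and nabla :: "(real ^ 3 \<Rightarrow> real ^ 3) \<Rightarrow> (real ^ 3 \<Rightarrow> real ^ 3) \<Rightarrow> real ^ 3 \<Rightarrow> real ^ 3"
    and \<eta> :: "real ^ 3 \<Rightarrow> real ^ 3 \<Rightarrow> real"
    and \<eta>c :: "3 \<Rightarrow> real ^ 3 \<Rightarrow> real"
  assumes "open I1" "is_interval I1" "open I2" "is_interval I2" "open I3" "is_interval I3"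
    and "I = product_box I1 I2 I3"
    and "smooth_fun_on I f1" "\<forall>x\<in>I. f1 x \<noteq> 0"
    and "smooth_fun_on I f2" "\<forall>x\<in>I. f2 x \<noteq> 0"
    and "g = diag_metric f1 f2"
    and "E = diag_frame f1 f2"
    and "dual_coframe_on I E e"
    and "levi_civita_on I g nabla"
    and "almost_eta_ricci_soliton I g nabla E (coord_field 3) \<eta> lam \<mu>"
    and "\<forall>x\<in>I. \<forall>y\<in>I. x $ 2 = y $ 2 \<longrightarrow> f1 x = f1 y \<and> f2 x = f2 y"
    and "\<forall>x\<in>I. \<forall>v. \<eta> x v = (\<Sum>k\<in>UNIV. \<eta>c k x * e k x v)"
    and "\<forall>x\<in>I. \<eta>c 1 x = f x \<and> \<eta>c 2 x = f x \<and> \<eta>c 3 x = f x"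
    and "\<forall>x\<in>I. \<mu> x \<noteq> 0"
  shows "(\<forall>x\<in>I. \<forall>v. \<eta> x v = 0) \<and> (\<forall>x\<in>I. lam x = 0) \<and>
    ((\<exists>c. \<forall>x\<in>I. f1 x = c) \<or>
     ((\<forall>x\<in>I. partial_deriv 2 f1 x \<noteq> 0) \<and>
      (\<exists>c0. c0 \<noteq> 0 \<and> (\<forall>x\<in>I. f2 x = c0 * ((f1 x)\<^sup>2 / partial_deriv 2 f1 x)))))"
proof -
  have "open I"
    unfolding \<open>I = product_box I1 I2 I3\<close> by (rule open_product_box) fact+
  have "convex I"
    unfolding \<open>I = product_box I1 I2 I3\<close>
    using assms(2,4,6) by (intro convex_product_box is_interval_convex)
  interpret diag_levi_civita I f1 f2 nabla
  proof unfold_locales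
    show "depends_only_on 2 I f1" "depends_only_on 2 I f2"
      using assms(17) unfolding depends_only_on_def by meson+
    show "levi_civita_on I (diag_metric f1 f2) nabla"
      using assms(12,15) by simp
  qed (use \<open>open I\<close> assms(8-11) in auto)
  have soliton: "ricci (diag_metric f1 f2) nabla (diag_frame f1 f2) (\<partial> i) (\<partial> j) x
      + lam x * eval_bilin (diag_metric f1 f2) (\<partial> i) (\<partial> j) x
      + \<mu> x * (\<eta> x (\<partial> i x) * \<eta> x (\<partial> j x)) = 0" if x: "x \<in> I" for i j x
  proof -
    have "1 / 2 * lie_deriv_bilin (\<partial> 3) g (\<partial> i) (\<partial> j) x + ricci g nabla E (\<partial> i) (\<partial> j) x
      + lam x * eval_bilin g (\<partial> i) (\<partial> j) x
      + \<mu> x * (eval_form \<eta> (\<partial> i) x * eval_form \<eta> (\<partial> j) x) = 0"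
      using assms(16) smooth_coord x unfolding almost_eta_ricci_soliton_def by blast
    then show ?thesis
      unfolding \<open>g = diag_metric f1 f2\<close> \<open>E = diag_frame f1 f2\<close> eval_form_def lie_deriv_coord_3[OF x]
      by simp
  qed
  have f: "f x = 0" if x: "x \<in> I" for x
  proof -
    note e = dual_coframe_diag_frame[OF assms(14)[unfolded \<open>E = diag_frame f1 f2\<close>] x]
    have "f1 x * \<eta> x (\<partial> 1 x) = (\<Sum>k\<in>UNIV. \<eta>c k x * (f1 x * e k x (\<partial> 1 x)))"
      using assms(18) x by (simp add: sum_distrib_left mult.left_commute)
    also have "\<dots> = f x"
      using assms(19) x by (simp add: e sum_3)
    finally have 1: "f1 x * \<eta> x (\<partial> 1 x) = f x" .
    have 3: "\<eta> x (\<partial> 3 x) = f x"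
      using assms(18,19) x by (simp add: e sum_3)
    \<comment> \<open>The Ricci and metric terms of the (1,3) component vanish and
      \<open>\<mu> x\<close> can be divided out. Multiplying by \<open>f1 x\<close> then turns the
      product into the square of \<open>f x\<close>.\<close>
    have "\<eta> x (\<partial> 1 x) * \<eta> x (\<partial> 3 x) = 0"
      using soliton[OF x, of 1 3] assms(20) x
      by (simp add: ricci_coord_3[OF x] eval_bilin_diag_metric)
    with 1 3 show ?thesis by auto
  qed
  have \<eta>: "\<eta> x v = 0" if "x \<in> I" for x v
    using assms(18,19) f that by (simp add: sum_3)
  \<comment> \<open>Since \<open>\<partial> 3\<close> has length 1, \<open>lam x\<close> is all that
    remains of the (3,3) component.\<close>
  have lam: "lam x = 0" if x: "x \<in> I" for x
    using soliton[OF x, of 3 3] by (simp add: \<eta>[OF x] ricci_coord_3[OF x] eval_bilin_diag_metric)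
  have "ricci (diag_metric f1 f2) nabla (diag_frame f1 f2) (\<partial> 1) (\<partial> 1) x = 0" if x: "x \<in> I" for x
    using soliton[OF x, of 1 1] by (simp add: \<eta>[OF x] lam[OF x])
  from f1_alternative[OF \<open>convex I\<close> this] show ?thesis
    using \<eta> lam by blast
qed

end
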